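(* Let $n\ge 6$ be an even integer, $t=n/2$, let $W_1,\ldots,W_{3^t+1}$ be $t$-dimensional subspaces of $\mathbb{F}_3^n$ with pairwise intersection $\{\mathbf{0}\}$, let $1\le s\le \frac{3^t+1}{2}$, let $i_1,\ldots,i_{2s}$ be distinct elements of $\{1,\ldots,3^t+1\}$, and let $f=\sum_{k=1}^{s} f_{i_k i_{s+k}}:\mathbb{F}_3^n\to\mathbb{F}_3$ (with $f_{ij}$ as defined in the context). If $s\neq\frac{3^t+1}{2}$, then $\mathscr{C}_f$ is a $[3^n-1,n+1]$ minimal linear code over $\mathbb{F}_3$. Moreover, if $s\le 3^{t-2}$, then $\frac{\mathrm{wt}_{min}}{\mathrm{wt}_{max}}\le\frac13<\frac23$, where $\mathrm{wt}_{min}$ and $\mathrm{wt}_{max}$ are the minimum and maximum nonzero Hamming weights of $\mathscr{C}_f$.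
   Context: For $i\neq j$ in $\{1,\ldots,3^t+1\}$, $f_{ij}:\mathbb{F}_3^n\to\mathbb{F}_3=\{0,1,2\}$ is defined by $f_{ij}(\mathbf{x})=1$ if $\mathbf{x}\in W_i\setminus\{\mathbf{0}\}$, $f_{ij}(\mathbf{x})=2$ if $\mathbf{x}\in W_j\setminus\{\mathbf{0}\}$, and $f_{ij}(\mathbf{x})=0$ otherwise. For a function $f:\mathbb{F}_3^n\to\mathbb{F}_3$, $$\mathscr{C}_f=\{(\alpha f(\mathbf{x})+\mathbf{w}\cdot\mathbf{x})_{\mathbf{x}\in\mathbb{F}_3^n\setminus\{\mathbf{0}\}} \mid \alpha\in\mathbb{F}_3,\ \mathbf{w}\in\mathbb{F}_3^n\},$$ where $\cdot$ is the standard inner product; coordinates are indexed by the nonzero vectors of $\mathbb{F}_3^n$. An $[N,k]$ linear code over $\mathbb{F}_3$ is a $k$-dimensional subspace of $\mathbb{F}_3^N$. The support $\mathrm{Supp}(\mathbf{c})$ of a codeword is the set of coordinates where it is nonzero, and its Hamming weight is the size of its support. A codeword $\mathbf{c}_2$ covers $\mathbf{c}_1$ if $\mathrm{Supp}(\mathbf{c}_1)\subseteq\mathrm{Supp}(\mathbf{c}_2)$. A nonzero codeword $\mathbf{c}$ is minimal if the only nonzero codewords it covers are $\alpha\mathbf{c}$ with $\alpha\in\mathbb{F}_3^*$; a code is minimal if every nonzero codeword in it is minimal. *)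

theory Defs
  imports "HOL-Analysis.Analysis"
begin

(* The field with three elements is rendered as an arbitrary field 'a with CARD('a) = 3,
   and its n-dimensional coordinate space as 'a ^ 'n with CARD('n) = n.  Subspaces and
   dimensions over 'a are those of the library interpretation vec (scalar multiplication *s). *)

(* The coordinate positions of the code are the nonzero vectors; as an index type they make
   the code a subset of the coordinate space 'a ^ ('a, 'n) nonzero_vec. *)
typedef (overloaded) ('a, 'n) nonzero_vec = "{x :: 'a::zero_neq_one ^ 'n::finite. x \<noteq> 0}"
proof
  show "(1 :: 'a ^ 'n) \<in> {x. x \<noteq> 0}"
    by (simp add: vec_eq_iff)
qed

instance nonzero_vec :: ("{zero_neq_one, finite}", finite) finite
proof
  have "finite (Rep_nonzero_vec ` (UNIV :: ('a, 'b) nonzero_vec set))"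
    by (rule finite)
  then show "finite (UNIV :: ('a, 'b) nonzero_vec set)"
    by (rule finite_imageD) (simp add: Rep_nonzero_vec_inject inj_on_def)
qed

(* The inner product of the library is restricted to real inner product spaces. *)
definition dot :: "'a::comm_ring_1 ^ 'n \<Rightarrow> 'a ^ 'n \<Rightarrow> 'a" where
  "dot w x = (\<Sum>j\<in>UNIV. w $ j * x $ j)"

definition linear_code :: "nat \<Rightarrow> nat \<Rightarrow> ('a::field ^ 'c) set \<Rightarrow> bool" where
  "linear_code N k C \<longleftrightarrow> CARD('c) = N \<and> vec.subspace C \<and> vec.dim C = k"

definition Supp :: "'a::zero ^ 'c \<Rightarrow> 'c set" where
  "Supp c = {p. c $ p \<noteq> 0}"

definition hamming_weight :: "'a::zero ^ 'c \<Rightarrow> nat" where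
  "hamming_weight c = card (Supp c)"

definition covers :: "'a::zero ^ 'c \<Rightarrow> 'a ^ 'c \<Rightarrow> bool" where
  "covers c2 c1 \<longleftrightarrow> Supp c1 \<subseteq> Supp c2"

definition minimal_codeword :: "('a::field ^ 'c) set \<Rightarrow> 'a ^ 'c \<Rightarrow> bool" where
  "minimal_codeword C c \<longleftrightarrow> c \<in> C \<and> c \<noteq> 0 \<and>
     (\<forall>c'\<in>C. c' \<noteq> 0 \<and> covers c c' \<longrightarrow> (\<exists>\<alpha>. \<alpha> \<noteq> 0 \<and> c' = \<alpha> *s c))"

definition minimal_code :: "('a::field ^ 'c) set \<Rightarrow> bool" where
  "minimal_code C \<longleftrightarrow> (\<forall>c\<in>C. c \<noteq> 0 \<longrightarrow> minimal_codeword C c)"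

(* Meaningful for codes with a nonzero codeword, over a finite field. *)
definition wt_min :: "('a::zero ^ 'c) set \<Rightarrow> nat" where
  "wt_min C = Min (hamming_weight ` (C - {0}))"

definition wt_max :: "('a::zero ^ 'c) set \<Rightarrow> nat" where
  "wt_max C = Max (hamming_weight ` (C - {0}))"

definition code_of ::
  "('a::{field, finite} ^ 'n \<Rightarrow> 'a) \<Rightarrow> ('a ^ ('a, 'n) nonzero_vec) set" where
  "code_of f = {(\<chi> p. \<alpha> * f (Rep_nonzero_vec p) + dot w (Rep_nonzero_vec p)) | \<alpha> w. True}"

definition f_pair :: "(nat \<Rightarrow> ('a::field ^ 'n) set) \<Rightarrow> nat \<Rightarrow> nat \<Rightarrow> 'a ^ 'n \<Rightarrow> 'a" where
  "f_pair W i j x = (if x \<in> W i - {0} then 1 else if x \<in> W j - {0} then 2 else 0)"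

end

theory Submission
  imports Defs
begin

text \<open>
  A word \<open>\<beta> f(x) + v \<cdot> x\<close> covered by \<open>\<alpha> f(x) + w \<cdot> x\<close> vanishes on the zeros of the latter.
  If \<open>\<alpha> = 0\<close> or \<open>w = 0\<close>, the zeros are so many that evenness of \<open>f\<close>, or the fact that two members of
  the spread span the space, forces proportionality. Otherwise a multiple of the covering word may
  be subtracted, so the covered word is a linear form \<open>u\<close>. On each \<open>W\<^sub>j\<close> on which \<open>f\<close> is a nonzero
  constant and \<open>w\<close> is nonzero, the zeros form an affine hyperplane missing the origin; it spans
  \<open>W\<^sub>j\<close>, so \<open>u\<close> vanishes on \<open>W\<^sub>j\<close>. Since \<open>w\<close> vanishes on at most one \<open>W\<^sub>j\<close>, this settles \<open>s \<ge> 2\<close>. For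
  \<open>s = 1\<close> one uses that \<open>u\<close> is a multiple of \<open>w\<close> on every \<open>W\<^sub>j\<close> outside the support of \<open>f\<close>, and there
  are more such \<open>W\<^sub>j\<close> than scalars.
\<close>

section \<open>Linear forms on subspaces, sizes and sums of subspaces\<close>

lemma dot_add_right: "dot w (x + y) = dot w x + dot w y"
  by (simp add: dot_def algebra_simps sum.distrib)

lemma dot_scale_right: "dot w (a *s x) = a * dot w x"
  by (simp add: dot_def sum_distrib_left algebra_simps)

lemma dot_scale_left: "dot (a *s w) x = a * dot w x"
  by (simp add: dot_def sum_distrib_left algebra_simps)

lemma dot_diff_right: "dot w (x - y) = dot w x - dot w y"
  by (simp add: dot_def algebra_simps sum_subtractf)

lemma dot_diff_left: "dot (u - w) x = dot u x - dot w x"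
  by (simp add: dot_def algebra_simps sum_subtractf)

lemma dot_minus_right: "dot w (- x) = - dot w x"
  by (simp add: dot_def sum_negf)

lemma dot_zero_left [simp]: "dot 0 x = 0"
  by (simp add: dot_def)

lemma dot_zero_right [simp]: "dot w 0 = 0"
  by (simp add: dot_def)

lemma dot_axis: "dot w (axis j 1) = w $ j"
  by (simp add: dot_def axis_def if_distrib cong: if_cong)

lemma dot_axis_left: "dot (axis j 1) x = x $ j"
  by (simp add: dot_def axis_def if_distrib if_distribR cong: if_cong)

lemma dot_nondegenerate: "(\<And>x. dot w x = 0) \<Longrightarrow> w = 0"
  by (metis dot_axis vec_eq_iff zero_index)

text \<open>If \<open>w\<close> is nonzero at some \<open>a\<close> in \<open>U\<close>, subtracting
  a suitable multiple of \<open>a\<close> moves any \<open>x\<close> into the kernel of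
  \<open>w\<close>, where \<open>u\<close> vanishes; this fixes the scalar. If \<open>w\<close>
  vanishes on \<open>U\<close>, so does \<open>u\<close>, and any scalar works.\<close>

lemma dot_proportional_on:
  fixes U :: "('a::field ^ 'n) set"
  assumes U: "vec.subspace U"
    and ker: "\<And>x. x \<in> U \<Longrightarrow> dot w x = 0 \<Longrightarrow> dot u x = 0"
  shows "\<exists>l. \<forall>x\<in>U. dot u x = l * dot w x"
proof (cases "\<exists>a\<in>U. dot w a \<noteq> 0")
  case True
  then obtain a where a: "a \<in> U" "dot w a \<noteq> 0" by blast
  have "dot u x = (dot u a / dot w a) * dot w x" if x: "x \<in> U" for x
  proof -
    have "x - (dot w x / dot w a) *s a \<in> U"
      using U a x by (simp add: vec.subspace_diff vec.subspace_scale)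
    moreover have "dot w (x - (dot w x / dot w a) *s a) = 0"
      using a by (simp add: dot_diff_right dot_scale_right)
    ultimately have "dot u (x - (dot w x / dot w a) *s a) = 0"
      by (rule ker)
    then show ?thesis
      by (simp add: dot_diff_right dot_scale_right)
  qed
  then show ?thesis by blast
next
  case False
  then show ?thesis using ker by auto
qed

text \<open>As \<open>c\<close> is nonzero, every vector off the kernel of \<open>w\<close> rescales
  into the slice. A kernel vector \<open>x\<close> is the difference of \<open>x + a\<close> and
  \<open>a\<close>, both off the kernel.\<close>

lemma dot_vanishes_of_affine_slice:
  fixes U :: "('a::field ^ 'n) set"
  assumes U: "vec.subspace U"
    and c: "c \<noteq> 0"
    and a: "a \<in> U" "dot w a \<noteq> 0"
    and slice: "\<And>x. x \<in> U \<Longrightarrow> dot w x = c \<Longrightarrow> dot u x = 0"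
    and x: "x \<in> U"
  shows "dot u x = 0"
proof -
  have nonzero: "dot u y = 0" if y: "y \<in> U" "dot w y \<noteq> 0" for y
  proof -
    have "dot u ((c / dot w y) *s y) = 0"
      using y U by (intro slice) (auto simp: dot_scale_right vec.subspace_scale)
    then show ?thesis
      using c y by (simp add: dot_scale_right)
  qed
  show ?thesis
  proof (cases "dot w x = 0")
    case True
    have "dot u (x + a) = 0"
      using True a x U by (intro nonzero) (auto simp: dot_add_right vec.subspace_add)
    then show ?thesis
      using nonzero[OF a] by (simp add: dot_add_right)
  qed (use nonzero x in blast)
qed

lemma exists_nonzero_orthogonal:
  fixes U :: "('a::field ^ 'n) set"
  assumes U: "vec.subspace U" and dim: "2 \<le> vec.dim U"
  shows "\<exists>x\<in>U. x \<noteq> 0 \<and> dot w x = 0"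
proof -
  have "\<not> U \<subseteq> {0}"
    using dim by (metis vec.dim_eq_0 not_numeral_le_zero)
  then obtain a where a: "a \<in> U" "a \<noteq> 0" by blast
  show ?thesis
  proof (cases "dot w a = 0")
    case True
    then show ?thesis using a by blast
  next
    case False
    have "\<not> U \<subseteq> vec.span {a}"
    proof
      assume "U \<subseteq> vec.span {a}"
      then have "vec.dim U \<le> vec.dim {a}" by (rule vec.dim_mono)
      also have "\<dots> \<le> card {a}" by (rule vec.dim_le_card') simp
      finally show False using dim by simp
    qed
    then obtain b where b: "b \<in> U" "b \<notin> vec.span {a}" by blast
    \<comment> \<open>This combination cancels the values of \<open>w\<close>; it is nonzero because
      \<open>b\<close> is independent of \<open>a\<close>.\<close>
    let ?x = "b - (dot w b / dot w a) *s a"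
    have "?x \<in> U" using U a b by (simp add: vec.subspace_diff vec.subspace_scale)
    moreover have "?x \<noteq> 0"
    proof
      assume "?x = 0"
      then have "b = (dot w b / dot w a) *s a" by simp
      moreover have "(dot w b / dot w a) *s a \<in> vec.span {a}"
        by (intro vec.span_scale vec.span_base) simp
      ultimately show False using b by metis
    qed
    moreover have "dot w ?x = 0"
      using False by (simp add: dot_diff_right dot_scale_right)
    ultimately show ?thesis by blast
  qed
qed

lemma card_subspace_le:
  fixes U :: "('a::{field,finite} ^ 'n) set"
  assumes "vec.subspace U"
  shows "card U \<le> CARD('a) ^ vec.dim U"
proof -
  obtain B where B: "finite B" "B \<subseteq> U" "vec.independent B" "vec.span B = U" "card B = vec.dim U"
    by (rule vec.basis_subspace_exists[OF assms])
  have "U \<subseteq> (\<lambda>g. \<Sum>b\<in>B. g b *s b) ` (B \<rightarrow>\<^sub>E (UNIV :: 'a set))"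
  proof
    fix x assume "x \<in> U"
    then obtain g where "x = (\<Sum>b\<in>B. g b *s b)"
      unfolding B(4)[symmetric] vec.span_finite[OF B(1)] by blast
    then show "x \<in> (\<lambda>g. \<Sum>b\<in>B. g b *s b) ` (B \<rightarrow>\<^sub>E UNIV)"
      \<comment> \<open>Restriction makes the coefficient function extensional, so that only its
        values on the basis are counted.\<close>
      by (intro image_eqI[where x = "restrict g B"]) simp_all
  qed
  then have "card U \<le> card ((\<lambda>g. \<Sum>b\<in>B. g b *s b) ` (B \<rightarrow>\<^sub>E (UNIV :: 'a set)))"
    by (intro card_mono) auto
  also have "\<dots> \<le> card (B \<rightarrow>\<^sub>E (UNIV :: 'a set))"
    by (intro card_image_le finite_PiE) (auto simp: B)
  also have "\<dots> = CARD('a) ^ vec.dim U"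
    using B by (simp add: card_PiE)
  finally show ?thesis .
qed

text \<open>By the dimension formula the sum of the two subspaces has full dimension.\<close>

lemma complementary_subspaces_span:
  fixes U V :: "('a::field ^ 'n) set"
  assumes "vec.subspace U" "vec.subspace V" "U \<inter> V = {0}"
    and "vec.dim U + vec.dim V = CARD('n)"
  shows "\<exists>a\<in>U. \<exists>b\<in>V. x = a + b"
proof -
  let ?T = "{a + b |a b. a \<in> U \<and> b \<in> V}"
  have "vec.dim ?T + vec.dim (U \<inter> V) = vec.dim U + vec.dim V"
    using assms by (intro vec.dim_sums_Int) auto
  then have "vec.dim ?T = CARD('n)"
    using assms by simp
  then have "vec.span ?T = UNIV"
    using vec.dim_eq_full[of ?T] by (simp add: vec.dimension_def card_cart_basis)
  moreover have "vec.span ?T = ?T"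
    using assms by (simp add: vec.span_eq_iff vec.subspace_sums)
  ultimately have "x \<in> ?T" by simp
  then show ?thesis by blast
qed

section \<open>Codewords as functions on the whole space, and the dimension of the code\<close>

lemma card_nonzero_vec:
  "CARD(('a::{zero_neq_one,finite}, 'n::finite) nonzero_vec) = CARD('a) ^ CARD('n) - 1"
proof -
  have "CARD(('a, 'n) nonzero_vec) = card (- {0 :: 'a ^ 'n})"
    using type_definition.card[OF type_definition_nonzero_vec]
    by (simp add: Collect_neg_eq)
  then show ?thesis
    by (simp add: Compl_eq_Diff_UNIV card_Diff_subset)
qed

definition code_word ::
  "('a::{field, finite} ^ 'n \<Rightarrow> 'a) \<Rightarrow> 'a \<Rightarrow> 'a ^ 'n \<Rightarrow> 'a ^ ('a, 'n) nonzero_vec" where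
  "code_word f \<alpha> w = (\<chi> p. \<alpha> * f (Rep_nonzero_vec p) + dot w (Rep_nonzero_vec p))"

lemma code_of_eq: "code_of f = {code_word f \<alpha> w |\<alpha> w. True}"
  by (simp add: code_of_def code_word_def)

lemma code_word_scale: "code_word f (\<gamma> * \<alpha>) (\<gamma> *s w) = \<gamma> *s code_word f \<alpha> w"
  by (simp add: code_word_def vec_eq_iff dot_scale_left algebra_simps)

text \<open>When \<open>f 0 = 0\<close> every word extended to the origin is zero there, so
  conditions on coordinates can be tested on all vectors.\<close>

lemma all_nonzero_vec_iff:
  assumes "P 0"
  shows "(\<forall>p. P (Rep_nonzero_vec p)) \<longleftrightarrow> (\<forall>x. P x)"
proof -
  have "P x" if "\<forall>p. P (Rep_nonzero_vec p)" for x
  proof (cases "x = 0")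
    case False
    then show ?thesis
      using that[rule_format, of "Abs_nonzero_vec x"] by (simp add: Abs_nonzero_vec_inverse)
  qed (use assms in simp)
  then show ?thesis by blast
qed

lemma covers_code_word_iff:
  assumes "f 0 = 0"
  shows "covers (code_word f \<alpha> w) (code_word f \<beta> v) \<longleftrightarrow>
    (\<forall>x. \<alpha> * f x + dot w x = 0 \<longrightarrow> \<beta> * f x + dot v x = 0)"
  using assms
  by (subst all_nonzero_vec_iff[symmetric]) (auto simp: covers_def Supp_def code_word_def)

lemma code_word_eq_zero_iff:
  assumes "f 0 = 0"
  shows "code_word f \<alpha> w = 0 \<longleftrightarrow> (\<forall>x. \<alpha> * f x + dot w x = 0)"
  using assms
  by (subst all_nonzero_vec_iff[symmetric]) (auto simp: vec_eq_iff code_word_def)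

lemma hamming_weight_code_word:
  assumes "f 0 = 0"
  shows "hamming_weight (code_word f \<alpha> w) = card {x. \<alpha> * f x + dot w x \<noteq> 0}"
proof -
  have "Rep_nonzero_vec ` Supp (code_word f \<alpha> w) = {x. \<alpha> * f x + dot w x \<noteq> 0}"
  proof (intro equalityI subsetI)
    fix x assume x: "x \<in> {x. \<alpha> * f x + dot w x \<noteq> 0}"
    then have "x \<noteq> 0" using assms by auto
    then have "x = Rep_nonzero_vec (Abs_nonzero_vec x)"
      by (simp add: Abs_nonzero_vec_inverse)
    with x show "x \<in> Rep_nonzero_vec ` Supp (code_word f \<alpha> w)"
      by (intro image_eqI[where x = "Abs_nonzero_vec x"]) (auto simp: Supp_def code_word_def)
  qed (auto simp: Supp_def code_word_def)
  moreover have "inj_on Rep_nonzero_vec (Supp (code_word f \<alpha> w))"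
    by (simp add: inj_on_def Rep_nonzero_vec_inject)
  ultimately show ?thesis
    unfolding hamming_weight_def using card_image by fastforce
qed

text \<open>The message \<open>(\<alpha>, w)\<close> is packed into one vector indexed by \<open>'n option\<close>.\<close>

lemma linear_code_code_of:
  fixes f :: "'a::{field,finite} ^ 'n \<Rightarrow> 'a"
  assumes inj: "\<And>\<alpha> w. code_word f \<alpha> w = 0 \<Longrightarrow> \<alpha> = 0 \<and> w = 0"
  shows "linear_code (CARD('a) ^ CARD('n) - 1) (CARD('n) + 1) (code_of f)"
proof -
  define g where "g y = code_word f (y $ None) (\<chi> j. y $ Some j)" for y :: "'a ^ 'n option"
  have lin: "Vector_Spaces.linear (*s) (*s) g"
    by (auto simp: Vector_Spaces.linear_iff g_def code_word_def vec_eq_iff dot_def algebra_simps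
        sum.distrib sum_distrib_left intro: vec.vector_space_axioms)
  interpret g: Vector_Spaces.linear "(*s)" "(*s)" g by (rule lin)
  have "inj g"
    unfolding g.inj_iff_eq_0
  proof (intro allI impI)
    fix y assume "g y = 0"
    then have y: "y $ None = 0" "(\<chi> j. y $ Some j) = 0"
      using inj[of "y $ None" "\<chi> j. y $ Some j"] unfolding g_def by blast+
    have "y $ k = 0" for k
    proof (cases k)
      case (Some j)
      have "y $ Some j = (\<chi> j. y $ Some j) $ j" by simp
      with y(2) Some show ?thesis by (metis zero_index)
    qed (use y(1) in simp)
    then show "y = 0" by (simp add: vec_eq_iff)
  qed
  have range: "code_of f = range g"
  proof -
    have "code_word f \<alpha> w = g (\<chi> k. case k of None \<Rightarrow> \<alpha> | Some j \<Rightarrow> w $ j)" for \<alpha> w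
      by (simp add: g_def)
    moreover have "g y \<in> code_of f" for y
      by (auto simp: code_of_eq g_def)
    ultimately show ?thesis unfolding code_of_eq by blast
  qed
  have "vec.dim (range g) = vec.dim (UNIV :: ('a ^ 'n option) set)"
    using \<open>inj g\<close> by (intro vec.dim_image_eq lin) simp
  also have "\<dots> = CARD('n) + 1"
    by (simp only: vec_dim_card card_UNIV_option) simp
  finally show ?thesis
    unfolding linear_code_def range
    using g.subspace_image[OF vec.subspace_UNIV] card_nonzero_vec by blast
qed

section \<open>Covering and minimality for a function constant on members of a spanning
  family\<close>

lemma two_elements_of_card_ge_2:
  assumes "2 \<le> card A"
  shows "\<exists>x\<in>A. \<exists>y\<in>A. x \<noteq> y"
proof -
  obtain T where T: "T \<subseteq> A" "card T = 2"
    using obtain_subset_with_card_n[OF assms] by blast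
  then obtain x y where "T = {x, y}" "x \<noteq> y"
    unfolding card_2_iff by blast
  then show ?thesis using T by blast
qed

text \<open>Collects what the covering argument uses. Trivial intersection and half dimension appear
  as \<open>spanning\<close>; the members outside \<open>S\<close> are the spare ones, where
  \<open>f\<close> vanishes. The alternatives in \<open>large\<close> correspond to s >= 2 and s =
  1.\<close>

locale spread_function =
  fixes U :: "'j \<Rightarrow> ('a::{field,finite} ^ 'n) set"
    and J S :: "'j set"
    and f :: "'a ^ 'n \<Rightarrow> 'a"
  assumes finite_J: "finite J"
    and S_subset: "S \<subseteq> J"
    and two_support: "2 \<le> card S"
    and subspace: "j \<in> J \<Longrightarrow> vec.subspace (U j)"
    and dim: "j \<in> J \<Longrightarrow> 2 \<le> vec.dim (U j)"
    and spanning: "j \<in> J \<Longrightarrow> k \<in> J \<Longrightarrow> j \<noteq> k \<Longrightarrow> \<exists>a\<in>U j. \<exists>b\<in>U k. x = a + b"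
    and f_S: "j \<in> S \<Longrightarrow> \<exists>c. c \<noteq> 0 \<and> (\<forall>x\<in>U j - {0}. f x = c)"
    and f_spare: "j \<in> J - S \<Longrightarrow> x \<in> U j \<Longrightarrow> f x = 0"
    and even: "f (- x) = f x"
    and two_neq_zero: "(2 :: 'a) \<noteq> 0"
    and two_spare: "2 \<le> card (J - S)"
    and large: "3 \<le> card S \<or> CARD('a) < card (J - S)"
begin

lemma two_in_support: obtains j k where "j \<in> S" "k \<in> S" "j \<noteq> k"
  using two_elements_of_card_ge_2[OF two_support] by blast

lemma two_in_spare: obtains j k where "j \<in> J - S" "k \<in> J - S" "j \<noteq> k"
  using two_elements_of_card_ge_2[OF two_spare] by blast

lemma eq_zero_of_vanishing:
  assumes "j \<in> J" "k \<in> J" "j \<noteq> k"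
    and "\<And>x. x \<in> U j \<Longrightarrow> dot u x = 0" "\<And>x. x \<in> U k \<Longrightarrow> dot u x = 0"
  shows "u = 0"
proof (rule dot_nondegenerate)
  fix x
  obtain a b where "a \<in> U j" "b \<in> U k" "x = a + b"
    using spanning assms by meson
  then show "dot u x = 0"
    using assms by (simp add: dot_add_right)
qed

text \<open>A linear form is odd and \<open>f\<close> is even, so agreement at \<open>x\<close> and
  \<open>- x\<close> gives \<open>2 * f x = 0\<close>. The kernel of \<open>w\<close> meets a
  supporting member in a nonzero vector, where \<open>f\<close> is nonzero.\<close>

lemma not_linear_on_orthogonal: "\<not> (\<forall>x. dot w x = 0 \<longrightarrow> f x = dot v x)"
proof
  assume lin: "\<forall>x. dot w x = 0 \<longrightarrow> f x = dot v x"
  obtain j where j: "j \<in> S" using two_in_support by blast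
  then have jJ: "j \<in> J" using S_subset by blast
  obtain x where x: "x \<in> U j" "x \<noteq> 0" "dot w x = 0"
    using exists_nonzero_orthogonal[OF subspace[OF jJ] dim[OF jJ]] by blast
  have "f x \<noteq> 0" using f_S[OF j] x by auto
  moreover have "f x = - f x"
    using lin[rule_format, of x] lin[rule_format, of "- x"] x even[of x]
    by (simp add: dot_minus_right)
  then have "2 * f x = 0" by (metis mult_2 add.right_inverse)
  ultimately show False using two_neq_zero by simp
qed

lemma f_zero: "f 0 = 0"
proof -
  obtain j where "j \<in> J - S" using two_in_spare by blast
  then show ?thesis using f_spare[of j 0] subspace[of j] vec.subspace_0 by auto
qed

lemma code_word_eq_zero: "code_word f \<alpha> w = 0 \<Longrightarrow> \<alpha> = 0 \<and> w = 0"
proof -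
  assume "code_word f \<alpha> w = 0"
  then have zero: "\<alpha> * f x + dot w x = 0" for x
    using code_word_eq_zero_iff f_zero by blast
  have "\<alpha> = 0"
  proof (rule ccontr)
    assume "\<alpha> \<noteq> 0"
    then have "f x = - 1 / \<alpha> * dot w x" for x
      using zero[of x] by (simp add: field_simps eq_neg_iff_add_eq_0)
    then have "f x = dot ((- 1 / \<alpha>) *s w) x" for x
      by (simp only: dot_scale_left)
    then show False using not_linear_on_orthogonal[of 0] by blast
  qed
  then show ?thesis using zero dot_nondegenerate by auto
qed

text \<open>With \<open>f\<close> equal to \<open>c\<close> on the nonzero vectors of
  \<open>U j\<close>, the slice \<open>dot w x = - c\<close> avoids the origin and consists of zeros
  of the word.\<close>

lemma vanishing_on_support:
  assumes "j \<in> S" "a \<in> U j" "dot w a \<noteq> 0"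
    and van: "\<And>x. f x + dot w x = 0 \<Longrightarrow> dot u x = 0"
    and "x \<in> U j"
  shows "dot u x = 0"
proof -
  obtain c where c: "c \<noteq> 0" "\<And>x. x \<in> U j - {0} \<Longrightarrow> f x = c"
    using f_S assms by blast
  show ?thesis
  proof (rule dot_vanishes_of_affine_slice[where c = "- c" and w = w and a = a and U = "U j"])
    fix y assume y: "y \<in> U j" "dot w y = - c"
    then have "y \<noteq> 0" using c by auto
    then show "dot u y = 0" using y c van by simp
  qed (use assms c subspace S_subset in auto)
qed

text \<open>The core case: the covering word has both parts nonzero and is normalised to coefficient
  1 of \<open>f\<close>, and the covered word is reduced to a linear form.\<close>

lemma eq_zero_of_vanishing_on_zeros:
  assumes w: "w \<noteq> 0"
    and van: "\<And>x. f x + dot w x = 0 \<Longrightarrow> dot u x = 0"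
  shows "u = 0"
proof -
  \<comment> \<open>The members on which \<open>w\<close> vanishes. Two of them would span the space
    and force \<open>w = 0\<close>, so there is at most one.\<close>
  define P where "P = {j \<in> J. \<forall>x\<in>U j. dot w x = 0}"
  have P: "j = k" if "j \<in> P" "k \<in> P" for j k
  proof (rule ccontr)
    assume "j \<noteq> k"
    then have "w = 0"
      using that by (intro eq_zero_of_vanishing[of j k]) (auto simp: P_def)
    then show False using w by simp
  qed
  have on_S: "dot u x = 0" if j: "j \<in> S - P" "x \<in> U j" for j x
  proof -
    obtain a where "a \<in> U j" "dot w a \<noteq> 0"
      using j S_subset unfolding P_def by blast
    then show ?thesis
      using vanishing_on_support[of j a w u x] van j by simp
  qed
  show ?thesis
  proof (cases "\<exists>j\<in>S - P. \<exists>k\<in>S - P. j \<noteq> k")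
    case True
    then obtain j k where jk: "j \<in> S - P" "k \<in> S - P" "j \<noteq> k" by blast
    then show ?thesis
      using on_S[OF jk(1)] on_S[OF jk(2)] S_subset by (intro eq_zero_of_vanishing[of j k]) auto
  next
    case False
    \<comment> \<open>At most one supporting member lies in \<open>P\<close> and at most one
      outside, which rules out the first alternative of \<open>large\<close>.\<close>
    have fin: "finite S" using S_subset finite_J by (rule finite_subset)
    have "card (S \<inter> P) \<le> 1" "card (S - P) \<le> 1"
      using False P fin by (auto simp: card_le_Suc0_iff_eq)
    moreover have "card S = card (S \<inter> P) + card (S - P)"
      using card_Int_Diff[OF fin] .
    ultimately have "card S \<le> 2" by simp
    then have many: "CARD('a) < card (J - S)" using large by simp
    have "\<exists>l. \<forall>x\<in>U j. dot u x = l * dot w x" if "j \<in> J - S" for j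
      using that f_spare van subspace by (intro dot_proportional_on) auto
    then obtain l where l: "\<And>j x. j \<in> J - S \<Longrightarrow> x \<in> U j \<Longrightarrow> dot u x = l j * dot w x"
      by metis
    \<comment> \<open>More spare members than scalars: two of them share the same factor, and since
      they span, \<open>u\<close> is a global multiple of \<open>w\<close>.\<close>
    have "card (l ` (J - S)) \<le> CARD('a)" by (intro card_mono) auto
    then have "\<not> inj_on l (J - S)" using many by (intro pigeonhole) simp
    then obtain j k where jk: "j \<in> J - S" "k \<in> J - S" "j \<noteq> k" "l j = l k"
      unfolding inj_on_def by blast
    have "u - l j *s w = 0"
      by (rule eq_zero_of_vanishing[of j k]) (use jk l in \<open>auto simp: dot_diff_left dot_scale_left\<close>)
    then have u: "u = l j *s w" by simp
    \<comment> \<open>On a supporting member outside \<open>P\<close>, \<open>u\<close> vanishes but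
      \<open>w\<close> does not, so the common factor is 0.\<close>
    obtain m where m: "m \<in> S - P"
      using two_in_support P by (metis DiffI)
    then obtain x where x: "x \<in> U m" "dot w x \<noteq> 0" using S_subset unfolding P_def by blast
    then have "l j = 0" using on_S[OF m x(1)] u by (simp add: dot_scale_left)
    then show ?thesis using u by simp
  qed
qed

text \<open>This is minimality stated for the messages: being covered forces the pair (\<beta>, v)
  to be a multiple of (\<alpha>, w).\<close>

lemma proportional_of_zeros_subset:
  assumes sub: "\<And>x. \<alpha> * f x + dot w x = 0 \<Longrightarrow> \<beta> * f x + dot v x = 0"
  shows "\<exists>\<gamma>. \<beta> = \<gamma> * \<alpha> \<and> v = \<gamma> *s w"
proof (cases "\<alpha> = 0")
  case True
  have "\<beta> = 0"
  proof (rule ccontr)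
    assume "\<beta> \<noteq> 0"
    then have "f x = - 1 / \<beta> * dot v x" if "dot w x = 0" for x
      using sub[of x] that True by (simp add: field_simps eq_neg_iff_add_eq_0)
    then have "f x = dot ((- 1 / \<beta>) *s v) x" if "dot w x = 0" for x
      using that by (simp only: dot_scale_left)
    then show False using not_linear_on_orthogonal by blast
  qed
  moreover obtain l where l: "\<And>x. dot v x = l * dot w x"
    using dot_proportional_on[of UNIV w v] sub True \<open>\<beta> = 0\<close> by auto
  have "v - l *s w = 0"
    by (rule dot_nondegenerate) (simp add: dot_diff_left dot_scale_left l)
  ultimately show ?thesis using True by auto
next
  case False
  \<comment> \<open>Subtracting this multiple of the covering word cancels \<open>f\<close> and
    leaves a linear form that still vanishes on the zeros.\<close>
  define u where "u = v - (\<beta> / \<alpha>) *s w"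
  have van: "dot u x = 0" if "\<alpha> * f x + dot w x = 0" for x
  proof -
    have "dot w x = - \<alpha> * f x" "dot v x = - \<beta> * f x"
      using that sub[OF that] by (simp_all add: eq_neg_iff_add_eq_0 add.commute)
    then show ?thesis
      using False by (simp add: u_def dot_diff_left dot_scale_left)
  qed
  have "u = 0"
  proof (cases "w = 0")
    case True
    \<comment> \<open>For \<open>w = 0\<close> the zeros contain all spare members, and two of these
      span the space.\<close>
    obtain j k where "j \<in> J - S" "k \<in> J - S" "j \<noteq> k" by (rule two_in_spare)
    then show ?thesis
      by (intro eq_zero_of_vanishing[of j k]) (auto intro!: van simp: True f_spare)
  next
    case w: False
    have "(1 / \<alpha>) *s w \<noteq> 0"
      using w False by (simp add: vec.scale_eq_0_iff)
    moreover have "dot u x = 0" if "f x + dot ((1 / \<alpha>) *s w) x = 0" for x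
    proof (rule van)
      have "\<alpha> * f x + dot w x = \<alpha> * (f x + dot ((1 / \<alpha>) *s w) x)"
        using False by (simp add: dot_scale_left field_simps)
      with that show "\<alpha> * f x + dot w x = 0" by simp
    qed
    ultimately show ?thesis by (rule eq_zero_of_vanishing_on_zeros)
  qed
  then show ?thesis
    using False by (intro exI[of _ "\<beta> / \<alpha>"]) (simp add: u_def)
qed

lemma minimal_code_code_of: "minimal_code (code_of f)"
  unfolding minimal_code_def minimal_codeword_def
proof (intro ballI impI conjI)
  fix c c'
  assume c: "c \<in> code_of f" "c \<noteq> 0" and c': "c' \<in> code_of f" "c' \<noteq> 0 \<and> covers c c'"
  obtain \<alpha> w \<beta> v where eq: "c = code_word f \<alpha> w" "c' = code_word f \<beta> v"
    using c c' unfolding code_of_eq by blast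
  have "\<And>x. \<alpha> * f x + dot w x = 0 \<Longrightarrow> \<beta> * f x + dot v x = 0"
    using c' eq covers_code_word_iff f_zero by blast
  then obtain \<gamma> where "\<beta> = \<gamma> * \<alpha>" "v = \<gamma> *s w"
    using proportional_of_zeros_subset by metis
  then have "c' = \<gamma> *s c"
    using eq code_word_scale by blast
  then show "\<exists>\<alpha>. \<alpha> \<noteq> 0 \<and> c' = \<alpha> *s c"
    using c' by auto
qed

end

section \<open>Weight of a coordinate form, and 2 in the three-element field\<close>

lemma card_coordinate_nonzero:
  "CARD('a) * card {x :: 'a::{field,finite} ^ 'n. x $ k \<noteq> 0} = (CARD('a) - 1) * CARD('a) ^ CARD('n)"
proof -
  let ?Z = "{x :: 'a ^ 'n. x $ k = 0}"
  \<comment> \<open>Splitting off coordinate \<open>k\<close> identifies the space with the field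
    times the hyperplane \<open>?Z\<close>.\<close>
  let ?g = "\<lambda>(c, x). x + axis k c :: 'a ^ 'n"
  have inj: "inj_on ?g (UNIV \<times> ?Z)"
  proof (rule inj_onI, clarify)
    fix c d and x y :: "'a ^ 'n"
    assume 0: "x $ k = 0" "y $ k = 0" and eq: "x + axis k c = y + axis k d"
    have "(x + axis k c) $ k = (y + axis k d) $ k" by (simp only: eq)
    then have "c = d" using 0 by (simp add: axis_def)
    then show "c = d \<and> x = y" using eq by simp
  qed
  have "?g ` (UNIV \<times> ?Z) = UNIV"
  proof -
    have "x \<in> ?g ` (UNIV \<times> ?Z)" for x
      by (rule image_eqI[where x = "(x $ k, x - axis k (x $ k))"]) (auto simp: axis_def)
    then show ?thesis by blast
  qed
  then have total: "CARD('a) * card ?Z = CARD('a) ^ CARD('n)"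
    using card_image[OF inj] by (simp add: card_cartesian_product)
  have "{x :: 'a ^ 'n. x $ k \<noteq> 0} = - ?Z" by auto
  then have "card {x :: 'a ^ 'n. x $ k \<noteq> 0} = CARD('a) ^ CARD('n) - card ?Z"
    by (simp add: Compl_eq_Diff_UNIV card_Diff_subset)
  then show ?thesis
    using total by (simp add: diff_mult_distrib diff_mult_distrib2)
qed

text \<open>In characteristic 2, an element \<open>a\<close> other than 0 and 1 would give four
  distinct elements 0, 1, \<open>a\<close>, \<open>a + 1\<close>.\<close>

lemma two_neq_zero_of_card_3:
  assumes "CARD('a::{field,finite}) = 3"
  shows "(2 :: 'a) \<noteq> 0"
proof
  assume 2: "(2 :: 'a) = 0"
  have "card {0, 1 :: 'a} \<noteq> card (UNIV :: 'a set)" using assms by simp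
  then have "{0, 1 :: 'a} \<noteq> UNIV" by metis
  then obtain a :: 'a where a: "a \<noteq> 0" "a \<noteq> 1" by blast
  have a1: "a + 1 \<noteq> 0"
  proof
    assume "a + 1 = 0"
    also have "0 = 1 + (1 :: 'a)" using 2 by simp
    finally show False using a(2) by simp
  qed
  have "card {0, 1, a, a + 1} \<le> card (UNIV :: 'a set)" by (intro card_mono) auto
  moreover have "card {0, 1, a, a + 1} = 4" using a a1 a[symmetric] a1[symmetric] by simp
  ultimately show False using assms by simp
qed

section \<open>Sums of \<open>f_pair\<close> over a spread: reduction to the locale, then the two
  weight estimates\<close>

theorem theorem3p6:
  fixes W :: "nat \<Rightarrow> ('a::{field, finite} ^ 'n) set"
    and n t s :: nat
    and i :: "nat \<Rightarrow> nat"
    and f :: "'a ^ 'n \<Rightarrow> 'a"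
  assumes "CARD('a) = 3"
    and "n = CARD('n)" and "n \<ge> 6" and "even n"
    and "t = n div 2"
    and "\<And>j. j \<in> {1..3 ^ t + 1} \<Longrightarrow> vec.subspace (W j) \<and> vec.dim (W j) = t"
    and "\<And>j k. \<lbrakk>j \<in> {1..3 ^ t + 1}; k \<in> {1..3 ^ t + 1}; j \<noteq> k\<rbrakk> \<Longrightarrow> W j \<inter> W k = {0}"
    and "1 \<le> s" and "real s \<le> (3 ^ t + 1) / 2"
    and "inj_on i {1..2 * s}" and "i ` {1..2 * s} \<subseteq> {1..3 ^ t + 1}"
    and "f = (\<lambda>x. \<Sum>k = 1..s. f_pair W (i k) (i (s + k)) x)"
  shows "(real s \<noteq> (3 ^ t + 1) / 2 \<longrightarrow>
            linear_code (3 ^ n - 1) (n + 1) (code_of f) \<and> minimal_code (code_of f)) \<and>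
         (s \<le> 3 ^ (t - 2) \<longrightarrow>
            real (wt_min (code_of f)) / real (wt_max (code_of f)) \<le> 1 / 3 \<and> 1 / 3 < (2 / 3 :: real))"
proof -
  let ?J = "{1..3 ^ t + 1 :: nat}" and ?S = "i ` {1..2 * s}"
  note q = assms(1) and W_subspace = assms(6) and W_disjoint = assms(7) and inj = assms(10)
    and S_subset = assms(11)
  have n: "n = 2 * t" "3 \<le> t" using assms(3-5) by auto
  have card_S: "card ?S = 2 * s" using card_image[OF inj] by simp
  have S_le: "2 * s \<le> 3 ^ t + 1" using card_mono[OF _ S_subset] card_S by simp
  have t3: "27 \<le> (3 :: nat) ^ t"
    using power_increasing[OF n(2), of "3 :: nat"] by simp

  \<comment> \<open>A nonzero vector lies in at most one chosen member, so at most one summand of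
    \<open>f\<close> is nonzero there: lower indices give 1, upper ones 2.\<close>
  have in_W: "x \<in> W (i k) \<longleftrightarrow> k = m"
    if "m \<in> {1..2 * s}" "k \<in> {1..2 * s}" "x \<in> W (i m)" "x \<noteq> 0" for k m x
  proof
    assume "x \<in> W (i k)"
    then have "W (i m) \<inter> W (i k) \<noteq> {0}" using that by blast
    then have "i m = i k" using W_disjoint[of "i m" "i k"] S_subset that by blast
    then show "k = m" using inj that by (metis inj_onD)
  qed (use that in simp)
  have f_low: "f x = 1" if m: "m \<in> {1..s}" "x \<in> W (i m)" "x \<noteq> 0" for m x
  proof -
    have "f x = (\<Sum>k = 1..s. if k = m then 1 else 0)"
      unfolding assms(12) by (intro sum.cong refl) (use m in \<open>auto simp: f_pair_def in_W[of m]\<close>)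
    then show ?thesis using m by simp
  qed
  have f_high: "f x = 2" if m: "m \<in> {1..s}" "x \<in> W (i (s + m))" "x \<noteq> 0" for m x
  proof -
    have "f x = (\<Sum>k = 1..s. if k = m then 2 else 0)"
      unfolding assms(12)
      by (intro sum.cong refl) (use m in \<open>auto simp: f_pair_def in_W[of "s + m"]\<close>)
    then show ?thesis using m by simp
  qed
  have f_outside: "f x = 0" if "\<And>m. m \<in> {1..2 * s} \<Longrightarrow> x \<notin> W (i m) - {0}" for x
    unfolding assms(12)
  proof (intro sum.neutral ballI)
    fix k assume "k \<in> {1..s}"
    then show "f_pair W (i k) (i (s + k)) x = 0"
      using that[of k] that[of "s + k"] by (auto simp: f_pair_def)
  qed

  have spread: "spread_function W ?J ?S f" if s_less: "2 * s < 3 ^ t + 1"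
  proof
    fix j assume j: "j \<in> ?S"
    then obtain m where m: "m \<in> {1..2 * s}" "j = i m" by blast
    show "\<exists>c. c \<noteq> 0 \<and> (\<forall>x\<in>W j - {0}. f x = c)"
    proof (cases "m \<le> s")
      case True
      then show ?thesis using f_low m by (intro exI[of _ 1]) auto
    next
      case False
      then have "m - s \<in> {1..s}" "s + (m - s) = m" using m by auto
      then show ?thesis
        using f_high[of "m - s"] m two_neq_zero_of_card_3[OF q] by (intro exI[of _ 2]) auto
    qed
  next
    fix j x assume j: "j \<in> ?J - ?S" "x \<in> W j"
    show "f x = 0"
    proof (rule f_outside)
      fix m assume m: "m \<in> {1..2 * s}"
      then have "i m \<in> ?J" "j \<noteq> i m" using j(1) S_subset by blast+
      then have "W j \<inter> W (i m) = {0}" using j(1) by (intro W_disjoint) simp_all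
      then show "x \<notin> W (i m) - {0}" using j(2) by blast
    qed
  next
    fix j k x assume "j \<in> ?J" "k \<in> ?J" "j \<noteq> k"
    then show "\<exists>a\<in>W j. \<exists>b\<in>W k. x = a + b"
      using W_subspace[of j] W_subspace[of k] W_disjoint[of j k] n assms(2)
      by (intro complementary_subspaces_span) simp_all
  next
    fix x
    \<comment> \<open>Evenness holds because \<open>f_pair\<close> depends only on membership in
      subspaces, which are closed under negation.\<close>
    have neg: "- x \<in> W j \<longleftrightarrow> x \<in> W j" if "j \<in> ?J" for j
      using W_subspace[OF that] by (metis minus_minus vec.subspace_neg)
    have "f_pair W (i k) (i (s + k)) (- x) = f_pair W (i k) (i (s + k)) x"
      if "k \<in> {1..s}" for k
    proof -
      have "k \<in> {1..2 * s}" "s + k \<in> {1..2 * s}" using that by auto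
      then have "i k \<in> ?J" "i (s + k) \<in> ?J" using S_subset by blast+
      then show ?thesis by (simp add: f_pair_def neg)
    qed
    then show "f (- x) = f x"
      unfolding assms(12) by (intro sum.cong refl)
  next
    have "card (?J - ?S) = 3 ^ t + 1 - 2 * s"
      using card_Diff_subset[OF _ S_subset] card_S by simp
    \<comment> \<open>Parity excludes exactly one spare member, so strict inequality leaves at least
      two.\<close>
    moreover have "2 * s \<noteq> 3 ^ t"
    proof
      assume "2 * s = 3 ^ t"
      moreover have "odd (3 ^ t :: nat)" by simp
      ultimately show False by (metis dvd_triv_left)
    qed
    \<comment> \<open>For s >= 2 the support has at least 4 members; for s = 1 at least 26 spare
      members remain, by \<open>t3\<close>.\<close>
    ultimately show "2 \<le> card (?J - ?S)" "3 \<le> card ?S \<or> CARD('a) < card (?J - ?S)"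
      using s_less t3 assms(8) q card_S by linarith+
  next
    show "?S \<subseteq> ?J" by (rule S_subset)
    show "2 \<le> card ?S" using card_S assms(8) by simp
    show "(2 :: 'a) \<noteq> 0" by (rule two_neq_zero_of_card_3[OF q])
    show "vec.subspace (W j)" "2 \<le> vec.dim (W j)" if "j \<in> ?J" for j
      using W_subspace[OF that] n by simp_all
  qed simp

  have "linear_code (3 ^ n - 1) (n + 1) (code_of f) \<and> minimal_code (code_of f)"
    if "real s \<noteq> (3 ^ t + 1) / 2"
  proof -
    have "2 * s \<noteq> 3 ^ t + 1"
    proof
      assume "2 * s = 3 ^ t + 1"
      then have "real (2 * s) = real (3 ^ t + 1)" by (simp only:)
      then show False using that by simp
    qed
    then interpret spread_function W ?J ?S f using spread S_le by simp
    show ?thesis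
      using linear_code_code_of[OF code_word_eq_zero] minimal_code_code_of q assms(2) by simp
  qed
  moreover have "real (wt_min (code_of f)) / real (wt_max (code_of f)) \<le> 1 / 3"
    if s_le: "s \<le> 3 ^ (t - 2)"
  proof -
    have "2 + (t - 2) = t" using n by simp
    then have pow: "(3 :: nat) ^ t = 9 * 3 ^ (t - 2)"
      using power_add[of "3 :: nat" 2 "t - 2"] by (simp only:) simp
    \<comment> \<open>The bound on \<open>s\<close> already provides the spare members, so the
      locale applies without the premise of the first claim.\<close>
    then have "2 * s < 3 ^ t + 1" using s_le by linarith
    then interpret spread_function W ?J ?S f by (rule spread)
    have fin: "finite (hamming_weight ` (code_of f - {0}))" by simp
    \<comment> \<open>The word of \<open>f\<close> itself bounds the minimum: its support lies in 2s
      members of size at most 3^t, hence weight at most 2 * 3^(n-2).\<close>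
    have "code_word f 1 0 \<noteq> 0" using code_word_eq_zero by (metis one_neq_zero)
    then have "code_word f 1 0 \<in> code_of f - {0}" unfolding code_of_eq by blast
    then have "wt_min (code_of f) \<le> hamming_weight (code_word f 1 0)"
      unfolding wt_min_def by (intro Min_le fin imageI)
    also have "\<dots> = card {x. f x \<noteq> 0}"
      by (simp add: hamming_weight_code_word f_zero)
    also have "\<dots> \<le> card (\<Union>m\<in>{1..2 * s}. W (i m))"
    proof (rule card_mono)
      show "{x. f x \<noteq> 0} \<subseteq> (\<Union>m\<in>{1..2 * s}. W (i m))"
        using f_outside by blast
    qed simp
    also have "\<dots> \<le> (\<Sum>m\<in>{1..2 * s}. card (W (i m)))"
      by (rule card_UN_le) simp
    also have "\<dots> \<le> (\<Sum>m\<in>{1..2 * s}. 3 ^ t)"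
    proof (rule sum_mono)
      fix m assume "m \<in> {1..2 * s}"
      then have "i m \<in> ?J" using S_subset by blast
      then show "card (W (i m)) \<le> 3 ^ t"
        using card_subspace_le[of "W (i m)"] W_subspace q by metis
    qed
    also have "\<dots> = 2 * s * 3 ^ t" by simp
    also have "\<dots> \<le> 2 * 3 ^ (t - 2) * 3 ^ t" using s_le by simp
    finally have "9 * wt_min (code_of f) \<le> 9 * (2 * 3 ^ (t - 2) * 3 ^ t)"
      by (rule mult_le_mono2)
    also have "\<dots> = 2 * (9 * 3 ^ (t - 2) * 3 ^ t)"
      by simp
    also have "\<dots> = 2 * (3 ^ t * 3 ^ t)"
      by (simp only: pow)
    also have "\<dots> = 2 * 3 ^ n"
      by (simp only: n(1) mult_2[of t] power_add)
    finally have min: "9 * wt_min (code_of f) \<le> 2 * 3 ^ n" .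

    \<comment> \<open>A coordinate form, with an arbitrary coordinate, bounds the maximum from below
      by 2 * 3^(n-1), three times the previous bound.\<close>
    let ?k = "undefined :: 'n"
    let ?e = "axis ?k 1 :: 'a ^ 'n"
    have "?e \<noteq> 0" by (simp add: axis_eq_0_iff)
    then have "code_word f 0 ?e \<noteq> 0" using code_word_eq_zero by blast
    then have "code_word f 0 ?e \<in> code_of f - {0}" unfolding code_of_eq by blast
    then have "hamming_weight (code_word f 0 ?e) \<le> wt_max (code_of f)"
      unfolding wt_max_def by (intro Max_ge fin imageI)
    moreover have "hamming_weight (code_word f 0 ?e) = card {x :: 'a ^ 'n. x $ ?k \<noteq> 0}"
      by (simp add: hamming_weight_code_word f_zero dot_axis_left)
    moreover have "3 * card {x :: 'a ^ 'n. x $ ?k \<noteq> 0} = 2 * 3 ^ n"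
      using card_coordinate_nonzero[where 'a='a and k="?k"] q assms(2) by simp
    ultimately have max: "2 * 3 ^ n \<le> 3 * wt_max (code_of f)" by linarith
    \<comment> \<open>Positivity of the maximum makes the quotient a genuine one.\<close>
    moreover have "0 < (3 :: nat) ^ n" by simp
    ultimately have "0 < wt_max (code_of f)" by linarith
    moreover have "real (3 * wt_min (code_of f)) \<le> real (wt_max (code_of f))"
      using min max by linarith
    ultimately show ?thesis by (simp add: field_simps)
  qed
  ultimately show ?thesis by simp
qed

end
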